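(* Let $J$ be a countable index set, let $(x_j)_{j\in J}$ be a frame of a Hilbert space $H$ with Bessel bound $B$, and let $a_0>0$ be such that for all $x,y\in H$, $$\sum_{j\in J}\big||\langle x,x_j\rangle|^2-|\langle y,x_j\rangle|^2\big|^2\geq a_0\Big(\|x-y\|^2\|x+y\|^2-4\big(\operatorname{Im}\langle x,y\rangle\big)^2\Big).$$ Then $(x_j)_{j\in J}$ is a $4$-frame of $H$ with lower $4$-frame bound $a_0^{1/4}$ and upper $4$-frame bound $B^{1/2}$. Furthermore, $(x_j)_{j\in J}$ does $(2a_0^{-1}B)^{1/2}$-stable phase retrieval in $\ell_4(J)$.
   Context: A collection $(x_j)_{j\in J}$ in a Hilbert space $H$ is a frame of $H$ if there are constants $B'\geq A'>0$ with $A'\|x\|^2\leq\sum_{j\in J}|\langle x,x_j\rangle|^2\leq B'\|x\|^2$ for all $x\in H$. It has Bessel bound $B$ (equivalently, upper frame bound $B$) if $\sum_{j\in J}|\langle x,x_j\rangle|^2\leq B\|x\|^2$ for all $x\in H$. Let $1\leq p<\infty$. A countable family $(f_j)_{j\in J}$ in the dual $X^*$ of a Banach space $X$ is a $p$-frame of $X$ with lower $p$-frame bound $A_p$ and upper $p$-frame bound $B_p$ (where $0<A_p\leq B_p$) if $A_p\|x\|\leq\big(\sum_{j\in J}|f_j(x)|^p\big)^{1/p}\leq B_p\|x\|$ for all $x\in X$. A $p$-frame $(f_j)_{j\in J}$ of $X$ does $C$-stable phase retrieval in $\ell_p(J)$ if for all $x,y\in X$, $$\min_{|\lambda|=1}\|x-\lambda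 y\|\leq C\Big(\sum_{j\in J}\big||f_j(x)|-|f_j(y)|\big|^p\Big)^{1/p},$$ where the minimum is over scalars $\lambda$ with $|\lambda|=1$. A vector $x_j$ of a Hilbert space $H$ is identified with the functional $f_j(x)=\langle x,x_j\rangle$. *)

theory Defs
  imports "HOL-Analysis.Analysis"
begin

text \<open>
  Spaces over the real or the complex numbers are treated uniformly. The scalars form a normed
  field with a norm-preserving embedding over the reals into the complex numbers;
  by the lemma \<open>range_to_complex\<close> below, this leaves exactly the two possibilities of the
  real and the complex field.
\<close>

class rc_field = real_normed_field +
  fixes to_complex :: "'a \<Rightarrow> complex"
  assumes to_complex_add: "to_complex (a + b) = to_complex a + to_complex b"
    and to_complex_mult: "to_complex (a * b) = to_complex a * to_complex b"
    and to_complex_scaleR_one: "to_complex (r *\<^sub>R 1) = complex_of_real r"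
    and cmod_to_complex: "cmod (to_complex a) = norm a"

instantiation real :: rc_field
begin
definition to_complex_real :: "real \<Rightarrow> complex" where "to_complex_real = complex_of_real"
instance by standard (simp_all add: to_complex_real_def)
end

instantiation complex :: rc_field
begin
definition to_complex_complex :: "complex \<Rightarrow> complex" where "to_complex_complex = (\<lambda>z. z)"
instance by standard (simp_all add: to_complex_complex_def scaleR_conv_of_real)
end

lemma to_complex_of_real: "to_complex (of_real r :: 'k::rc_field) = complex_of_real r"
  by (simp add: of_real_def to_complex_scaleR_one flip: scaleR_conv_of_real)

lemma inj_to_complex: "inj (to_complex :: 'k::rc_field \<Rightarrow> complex)"
proof (rule injI)
  fix a b :: 'k
  assume "to_complex a = to_complex b"
  moreover have "to_complex ((a - b) + b) = to_complex (a - b) + to_complex b"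
    by (rule to_complex_add)
  ultimately have "to_complex (a - b) = 0" by simp
  then have "norm (a - b) = 0" using cmod_to_complex[of "a - b"] by simp
  then show "a = b" by simp
qed

lemma range_to_complex:
  "range (to_complex :: 'k::rc_field \<Rightarrow> complex) = \<real> \<or>
   range (to_complex :: 'k::rc_field \<Rightarrow> complex) = UNIV"
proof (cases "range (to_complex :: 'k \<Rightarrow> complex) \<subseteq> \<real>")
  case True
  have "z \<in> range (to_complex :: 'k \<Rightarrow> complex)" if "z \<in> \<real>" for z
  proof -
    from that obtain r where "z = complex_of_real r" by (auto elim: Reals_cases)
    then have "z = to_complex (of_real r :: 'k)" by (simp add: to_complex_of_real)
    then show ?thesis by blast
  qed
  with True show ?thesis by blast
next
  case False
  then obtain c :: 'k where c: "Im (to_complex c) \<noteq> 0"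
    using complex_is_Real_iff by blast
  have "z \<in> range (to_complex :: 'k \<Rightarrow> complex)" for z
  proof -
    define s where "s = Im z / Im (to_complex c)"
    define r where "r = Re z - s * Re (to_complex c)"
    have "to_complex (of_real r + of_real s * c) = of_real r + of_real s * to_complex c"
      by (simp only: to_complex_add to_complex_mult to_complex_of_real)
    also have "\<dots> = z"
      using c by (simp add: complex_eq_iff r_def s_def)
    finally have "z = to_complex (of_real r + of_real s * c)" ..
    then show ?thesis by blast
  qed
  then show ?thesis by blast
qed

text \<open>
  The class \<^class>\<open>banach\<close> supplies addition, the norm and completeness; the locales
  add the scalar multiplication by the field and the scalar-valued inner product.
\<close>

locale rc_banach_space = vector_space smul
  for smul :: "'k::rc_field \<Rightarrow> 'a::banach \<Rightarrow> 'a" +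
  assumes smul_of_real: "smul (of_real r) x = r *\<^sub>R x"
    and norm_smul: "norm (smul c x) = norm c * norm x"

text \<open>The inner product is linear in its first argument. Positive definiteness is
  contained in \<open>ip_self\<close>.\<close>

locale rc_hilbert_space = rc_banach_space smul
  for smul :: "'k::rc_field \<Rightarrow> 'a::banach \<Rightarrow> 'a" +
  fixes ip :: "'a \<Rightarrow> 'a \<Rightarrow> 'k"
  assumes ip_add_left: "ip (x + y) z = ip x z + ip y z"
    and ip_smul_left: "ip (smul c x) y = c * ip x y"
    and ip_conjugate: "to_complex (ip y x) = cnj (to_complex (ip x y))"
    and ip_self: "ip x x = of_real ((norm x)\<^sup>2)"

lemma rc_hilbert_space_real:
  "rc_hilbert_space (scaleR :: real \<Rightarrow> 'a \<Rightarrow> 'a::{real_inner, banach}) inner"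
  by unfold_locales
    (auto simp: algebra_simps inner_left_distrib to_complex_real_def inner_commute
      power2_norm_eq_inner)

lemma rc_hilbert_space_complex:
  "rc_hilbert_space ((*) :: complex \<Rightarrow> complex \<Rightarrow> complex) (\<lambda>x y. x * cnj y)"
  by unfold_locales
    (auto simp: algebra_simps scaleR_conv_of_real norm_mult to_complex_complex_def
      complex_norm_square simp del: of_real_power)

definition is_frame :: "('a::banach \<Rightarrow> 'a \<Rightarrow> 'k::rc_field) \<Rightarrow> 'i set \<Rightarrow> ('i \<Rightarrow> 'a) \<Rightarrow> bool" where
  "is_frame ip J v \<longleftrightarrow> (\<exists>A B. 0 < A \<and> A \<le> B \<and>
     (\<forall>x. (\<lambda>j. (norm (ip x (v j)))\<^sup>2) summable_on J \<and>
          A * (norm x)\<^sup>2 \<le> (\<Sum>\<^sub>\<infinity>j\<in>J. (norm (ip x (v j)))\<^sup>2) \<and>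
          (\<Sum>\<^sub>\<infinity>j\<in>J. (norm (ip x (v j)))\<^sup>2) \<le> B * (norm x)\<^sup>2))"

definition bessel_bound ::
    "('a::banach \<Rightarrow> 'a \<Rightarrow> 'k::rc_field) \<Rightarrow> 'i set \<Rightarrow> ('i \<Rightarrow> 'a) \<Rightarrow> real \<Rightarrow> bool" where
  "bessel_bound ip J v B \<longleftrightarrow>
     (\<forall>x. (\<lambda>j. (norm (ip x (v j)))\<^sup>2) summable_on J \<and>
          (\<Sum>\<^sub>\<infinity>j\<in>J. (norm (ip x (v j)))\<^sup>2) \<le> B * (norm x)\<^sup>2)"

definition dual_space :: "('k::rc_field \<Rightarrow> 'a::banach \<Rightarrow> 'a) \<Rightarrow> ('a \<Rightarrow> 'k) set" where
  "dual_space smul = {\<phi>. bounded_linear \<phi> \<and> (\<forall>c x. \<phi> (smul c x) = c * \<phi> x)}"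

definition p_frame ::
    "real \<Rightarrow> ('k::rc_field \<Rightarrow> 'a::banach \<Rightarrow> 'a) \<Rightarrow> 'i set \<Rightarrow> ('i \<Rightarrow> 'a \<Rightarrow> 'k) \<Rightarrow> real \<Rightarrow> real \<Rightarrow> bool" where
  "p_frame p smul J f A B \<longleftrightarrow>
     1 \<le> p \<and> countable J \<and> (\<forall>j\<in>J. f j \<in> dual_space smul) \<and> 0 < A \<and> A \<le> B \<and>
     (\<forall>x. (\<lambda>j. norm (f j x) powr p) summable_on J \<and>
          A * norm x \<le> (\<Sum>\<^sub>\<infinity>j\<in>J. norm (f j x) powr p) powr (1 / p) \<and>
          (\<Sum>\<^sub>\<infinity>j\<in>J. norm (f j x) powr p) powr (1 / p) \<le> B * norm x)"

text \<open>
  The infimum over the unit scalars is a minimum, by compactness of the set of unit scalars.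
  The series on the right converges because \<open>f\<close> is a \<open>p\<close>-frame (Minkowski's inequality), so
  the convention that \<^const>\<open>infsum\<close> is \<open>0\<close> on divergent series plays no role.
\<close>

definition stable_phase_retrieval ::
    "real \<Rightarrow> ('k::rc_field \<Rightarrow> 'a::banach \<Rightarrow> 'a) \<Rightarrow> 'i set \<Rightarrow> ('i \<Rightarrow> 'a \<Rightarrow> 'k) \<Rightarrow> real \<Rightarrow> bool" where
  "stable_phase_retrieval p smul J f C \<longleftrightarrow>
     (\<exists>A B. p_frame p smul J f A B) \<and>
     (\<forall>x y. (INF \<alpha>\<in>{\<alpha>. norm \<alpha> = 1}. norm (x - smul \<alpha> y))
        \<le> C * (\<Sum>\<^sub>\<infinity>j\<in>J. \<bar>norm (f j x) - norm (f j y)\<bar> powr p) powr (1 / p))"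

end

theory Submission imports Defs begin

text \<open>
  Write \<open>c\<^sub>j(x)\<close> for the modulus of \<open>\<langle>x, v\<^sub>j\<rangle>\<close>. Two observations carry the proof.

  First, the \<open>\<ell>\<^sub>4\<close> norm of the coefficients is controlled by their \<open>\<ell>\<^sub>2\<close> norm
  (\<open>infsum_square_le\<close>), so that the Bessel bound gives the upper \<open>4\<close>-frame bound. The lower one
  is the hypothesis at \<open>y = 0\<close>.

  Secondly, both sides of the stability estimate are unaffected when \<open>y\<close> is multiplied by a unit
  scalar, so one may assume that \<open>\<langle>x, y\<rangle>\<close> is real and nonnegative (\<open>ex_unit_aligning\<close>). Then
  the imaginary part in the hypothesis vanishes, and
  \<open>\<parallel>x + y\<parallel>\<^sup>2 \<ge> \<parallel>x\<parallel>\<^sup>2 + \<parallel>y\<parallel>\<^sup>2\<close>. Factoring \<open>c\<^sub>j(x)\<^sup>2 - c\<^sub>j(y)\<^sup>2\<close> as a difference of squares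
  and applying the Cauchy--Schwarz inequality to the two squared factors
  (\<open>infsum_diff_squares_le\<close>) bounds the left side of
  the hypothesis by the square root of \<open>\<Sum>(c\<^sub>j(x) - c\<^sub>j(y))\<^sup>4\<close> times
  the square root of \<open>\<Sum>(c\<^sub>j(x) + c\<^sub>j(y))\<^sup>4\<close>. The second
  root is at most \<open>2 B (\<parallel>x\<parallel>\<^sup>2 + \<parallel>y\<parallel>\<^sup>2)\<close>, and the factor \<open>\<parallel>x\<parallel>\<^sup>2 + \<parallel>y\<parallel>\<^sup>2\<close>
  cancels, leaving \<open>\<parallel>x - y\<parallel>\<^sup>2 \<le> 2 a\<^sub>0\<^sup>-\<^sup>1 B (\<Sum>(c\<^sub>j(x) - c\<^sub>j(y))\<^sup>4)\<^sup>1\<^sup>/\<^sup>2\<close>.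
\<close>

section \<open>Inequalities for infinite sums\<close>

lemma le_infsum_nonneg:
  fixes d :: "'i \<Rightarrow> real"
  assumes "d summable_on J" "\<And>j. j \<in> J \<Longrightarrow> 0 \<le> d j" "i \<in> J"
  shows "d i \<le> infsum d J"
  using finite_sum_le_infsum[of d J "{i}"] assms by simp

text \<open>The contractive inclusion of \<open>\<ell>\<^sub>1\<close> in \<open>\<ell>\<^sub>2\<close>: each entry is at most the total sum.\<close>

lemma infsum_square_le:
  fixes d :: "'i \<Rightarrow> real"
  assumes d: "d summable_on J" and nonneg: "\<And>j. j \<in> J \<Longrightarrow> 0 \<le> d j" and D: "infsum d J \<le> D"
  shows "(\<lambda>j. (d j)\<^sup>2) summable_on J" and "(\<Sum>\<^sub>\<infinity>j\<in>J. (d j)\<^sup>2) \<le> D\<^sup>2"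
proof -
  have le: "(d j)\<^sup>2 \<le> D * d j" if "j \<in> J" for j
    using mult_right_mono[of "d j" D "d j"] le_infsum_nonneg[OF d nonneg that] nonneg[OF that] D
    by (simp add: power2_eq_square)
  have D0: "0 \<le> D" using infsum_nonneg[of J d] nonneg D by simp
  have Dd: "(\<lambda>j. D * d j) summable_on J" using d by (rule summable_on_cmult_right)
  show *: "(\<lambda>j. (d j)\<^sup>2) summable_on J"
    by (rule summable_on_comparison_test[OF Dd]) (use le in auto)
  have "(\<Sum>\<^sub>\<infinity>j\<in>J. (d j)\<^sup>2) \<le> (\<Sum>\<^sub>\<infinity>j\<in>J. D * d j)"
    by (rule infsum_mono[OF * Dd]) (use le in auto)
  also have "\<dots> = D * infsum d J" by (rule infsum_cmult_right) (use d in auto)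
  also have "\<dots> \<le> D\<^sup>2" using D D0 by (simp add: power2_eq_square mult_left_mono)
  finally show "(\<Sum>\<^sub>\<infinity>j\<in>J. (d j)\<^sup>2) \<le> D\<^sup>2" .
qed

lemma infsum_Cauchy_Schwarz:
  fixes f g :: "'i \<Rightarrow> real"
  assumes f: "(\<lambda>j. (f j)\<^sup>2) summable_on J" and g: "(\<lambda>j. (g j)\<^sup>2) summable_on J"
    and nonneg: "\<And>j. j \<in> J \<Longrightarrow> 0 \<le> f j" "\<And>j. j \<in> J \<Longrightarrow> 0 \<le> g j"
  shows "(\<Sum>\<^sub>\<infinity>j\<in>J. f j * g j) \<le> sqrt (\<Sum>\<^sub>\<infinity>j\<in>J. (f j)\<^sup>2) * sqrt (\<Sum>\<^sub>\<infinity>j\<in>J. (g j)\<^sup>2)"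
proof (rule infsum_le_finite_sums)
  have le: "f j * g j \<le> (f j)\<^sup>2 + (g j)\<^sup>2" for j
    using sum_squares_bound[of "f j" "g j"] zero_le_power2[of "f j"] zero_le_power2[of "g j"]
    by linarith
  show "(\<lambda>j. f j * g j) summable_on J"
    by (rule summable_on_comparison_test[OF summable_on_add[OF f g]]) (use le nonneg in auto)
next
  fix F assume F: "finite F" "F \<subseteq> J"
  have "(\<Sum>j\<in>F. f j * g j) \<le> (\<Sum>j\<in>F. \<bar>f j\<bar> * \<bar>g j\<bar>)"
    by (rule sum_mono) (simp flip: abs_mult)
  also have "\<dots> \<le> sqrt (\<Sum>j\<in>F. (f j)\<^sup>2) * sqrt (\<Sum>j\<in>F. (g j)\<^sup>2)"
    using L2_set_mult_ineq[of f g F] by (simp add: L2_set_def)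
  also have "\<dots> \<le> sqrt (\<Sum>\<^sub>\<infinity>j\<in>J. (f j)\<^sup>2) * sqrt (\<Sum>\<^sub>\<infinity>j\<in>J. (g j)\<^sup>2)"
    by (intro mult_mono real_sqrt_le_mono finite_sum_le_infsum f g F)
      (auto intro!: sum_nonneg infsum_nonneg)
  finally show "(\<Sum>j\<in>F. f j * g j) \<le> \<dots>" .
qed

text \<open>
  Cauchy--Schwarz for \<open>f\<^sup>2 - g\<^sup>2 = (f - g) (f + g)\<close>, where the sum of \<open>(f + g)\<^sup>4\<close> is estimated
  by way of \<open>(f + g)\<^sup>2 \<le> 2 (f\<^sup>2 + g\<^sup>2)\<close>.
\<close>

lemma infsum_diff_squares_le:
  fixes f g :: "'i \<Rightarrow> real"
  assumes f: "(\<lambda>j. (f j)\<^sup>2) summable_on J" and g: "(\<lambda>j. (g j)\<^sup>2) summable_on J"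
    and D: "(\<Sum>\<^sub>\<infinity>j\<in>J. (f j)\<^sup>2) + (\<Sum>\<^sub>\<infinity>j\<in>J. (g j)\<^sup>2) \<le> D"
  shows "(\<Sum>\<^sub>\<infinity>j\<in>J. \<bar>(f j)\<^sup>2 - (g j)\<^sup>2\<bar>\<^sup>2) \<le> sqrt (\<Sum>\<^sub>\<infinity>j\<in>J. (f j - g j) ^ 4) * (2 * D)"
proof -
  let ?d = "\<lambda>j. 2 * ((f j)\<^sup>2 + (g j)\<^sup>2)"
  have d: "?d summable_on J"
    by (intro summable_on_cmult_right summable_on_add f g)
  have "infsum ?d J = 2 * ((\<Sum>\<^sub>\<infinity>j\<in>J. (f j)\<^sup>2) + (\<Sum>\<^sub>\<infinity>j\<in>J. (g j)\<^sup>2))"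
    using summable_on_add[OF f g]
    by (subst infsum_cmult_right) (simp_all add: infsum_add[OF f g])
  then have "infsum ?d J \<le> 2 * D" using D by simp
  note sq = infsum_square_le[OF d _ this]
  have "(f j + g j)\<^sup>2 \<le> ?d j" for j
    using sum_squares_bound[of "f j" "g j"] by (simp add: power2_sum)
  then have ple: "((f j + g j)\<^sup>2)\<^sup>2 \<le> (?d j)\<^sup>2" for j
    by (rule power_mono) simp
  have "(f j - g j)\<^sup>2 \<le> ?d j" for j
    using sum_squares_bound[of "f j" "- g j"] by (simp add: power2_diff)
  then have mle: "((f j - g j)\<^sup>2)\<^sup>2 \<le> (?d j)\<^sup>2" for j
    by (rule power_mono) simp
  have p: "(\<lambda>j. ((f j + g j)\<^sup>2)\<^sup>2) summable_on J"
    by (rule summable_on_comparison_test[OF sq(1)]) (use ple in auto)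
  have m: "(\<lambda>j. ((f j - g j)\<^sup>2)\<^sup>2) summable_on J"
    by (rule summable_on_comparison_test[OF sq(1)]) (use mle in auto)
  have "0 \<le> D" using D infsum_nonneg[of J "\<lambda>j. (f j)\<^sup>2"] infsum_nonneg[of J "\<lambda>j. (g j)\<^sup>2"] by simp
  have "(\<Sum>\<^sub>\<infinity>j\<in>J. ((f j + g j)\<^sup>2)\<^sup>2) \<le> (\<Sum>\<^sub>\<infinity>j\<in>J. (?d j)\<^sup>2)"
    by (rule infsum_mono[OF p sq(1)]) (use ple in auto)
  also have "\<dots> \<le> (2 * D)\<^sup>2" by (rule sq(2)) auto
  finally have sqrt_p: "sqrt (\<Sum>\<^sub>\<infinity>j\<in>J. ((f j + g j)\<^sup>2)\<^sup>2) \<le> 2 * D"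
    using \<open>0 \<le> D\<close> by (intro real_le_lsqrt) auto
  have "(\<Sum>\<^sub>\<infinity>j\<in>J. \<bar>(f j)\<^sup>2 - (g j)\<^sup>2\<bar>\<^sup>2) = (\<Sum>\<^sub>\<infinity>j\<in>J. (f j - g j)\<^sup>2 * (f j + g j)\<^sup>2)"
    by (rule infsum_cong) (simp add: power2_eq_square algebra_simps)
  also have "\<dots> \<le> sqrt (\<Sum>\<^sub>\<infinity>j\<in>J. ((f j - g j)\<^sup>2)\<^sup>2) * sqrt (\<Sum>\<^sub>\<infinity>j\<in>J. ((f j + g j)\<^sup>2)\<^sup>2)"
    by (rule infsum_Cauchy_Schwarz[OF m p]) auto
  also have "\<dots> \<le> sqrt (\<Sum>\<^sub>\<infinity>j\<in>J. ((f j - g j)\<^sup>2)\<^sup>2) * (2 * D)"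
    by (rule mult_left_mono[OF sqrt_p]) (auto intro!: infsum_nonneg)
  finally show ?thesis by (simp flip: power_mult)
qed

section \<open>Inner products and unit scalars\<close>

context rc_hilbert_space
begin

lemma to_complex_ip_add_right:
  "to_complex (ip x (y + z)) = to_complex (ip x y) + to_complex (ip x z)"
  by (metis complex_cnj_add ip_add_left ip_conjugate to_complex_add)

lemma to_complex_ip_smul_right:
  "to_complex (ip x (smul c y)) = cnj (to_complex c) * to_complex (ip x y)"
  by (metis complex_cnj_mult ip_conjugate ip_smul_left to_complex_mult)

lemma norm_ip_smul_left: "norm (ip (smul c x) y) = norm c * norm (ip x y)"
  by (simp add: ip_smul_left norm_mult)

lemma ip_zero_left: "ip 0 y = 0"
  using ip_add_left[of 0 0 y] by simp

lemma norm_add_square: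
  "(norm (x + y))\<^sup>2 = (norm x)\<^sup>2 + (norm y)\<^sup>2 + 2 * Re (to_complex (ip x y))"
proof -
  have *: "to_complex (ip z z) = complex_of_real ((norm z)\<^sup>2)" for z
    unfolding ip_self by (rule to_complex_of_real)
  have "complex_of_real ((norm (x + y))\<^sup>2) =
      of_real ((norm x)\<^sup>2) + of_real ((norm y)\<^sup>2)
      + (to_complex (ip x y) + cnj (to_complex (ip x y)))"
    using * [of "x + y"] * [of x] * [of y] ip_conjugate[of x y]
    by (simp add: ip_add_left to_complex_add to_complex_ip_add_right algebra_simps)
  also have "\<dots> = of_real ((norm x)\<^sup>2 + (norm y)\<^sup>2 + 2 * Re (to_complex (ip x y)))"
    by (simp add: complex_add_cnj)
  finally show ?thesis by (simp only: of_real_eq_iff)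
qed

text \<open>
  The inner product is conjugate-linear in its second argument, so multiplying \<open>y\<close> by the phase
  of \<open>\<langle>x, y\<rangle>\<close> cancels that phase.
\<close>

lemma ex_unit_aligning:
  obtains \<omega> where "norm \<omega> = 1"
    and "to_complex (ip x (smul \<omega> y)) = complex_of_real (norm (ip x y))"
proof (cases "ip x y = 0")
  case True
  then have "to_complex (ip x y) = 0" using cmod_to_complex[of "ip x y"] by simp
  then show ?thesis using True by (intro that[of 1]) (auto simp: to_complex_ip_smul_right)
next
  case False
  let ?r = "norm (ip x y)"
  \<comment> \<open>The phase of the inner product, which exists in the scalar field itself.\<close>
  define \<omega> where "\<omega> = of_real (inverse ?r) * ip x y"
  have unit: "norm \<omega> = 1" using False by (simp add: \<omega>_def norm_mult norm_inverse)
  have "to_complex \<omega> = of_real (inverse ?r) * to_complex (ip x y)"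
    by (simp only: \<omega>_def to_complex_mult to_complex_of_real)
  then have "to_complex (ip x (smul \<omega> y)) =
      of_real (inverse ?r) * (to_complex (ip x y) * cnj (to_complex (ip x y)))"
    by (simp add: to_complex_ip_smul_right mult_ac)
  also have "\<dots> = of_real (inverse ?r) * of_real (?r\<^sup>2)"
    using complex_norm_square[of "to_complex (ip x y)"] by (simp add: cmod_to_complex)
  also have "\<dots> = of_real ?r"
    using False by (simp add: power2_eq_square)
  finally show ?thesis by (rule that[OF unit])
qed

text \<open>Boundedness is read off from the Bessel inequality, a single term being at most the sum.\<close>

lemma bessel_imp_dual_space:
  assumes B: "bessel_bound ip J v B" and "j \<in> J"
  shows "(\<lambda>x. ip x (v j)) \<in> dual_space smul"
proof -
  have "norm (ip x (v j)) \<le> norm x * sqrt \<bar>B\<bar>" for x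
  proof (rule power2_le_imp_le)
    have "(norm (ip x (v j)))\<^sup>2 \<le> (\<Sum>\<^sub>\<infinity>j\<in>J. (norm (ip x (v j)))\<^sup>2)"
      using B \<open>j \<in> J\<close> le_infsum_nonneg[of "\<lambda>j. (norm (ip x (v j)))\<^sup>2"]
      by (auto simp: bessel_bound_def)
    also have "\<dots> \<le> B * (norm x)\<^sup>2" using B by (simp add: bessel_bound_def)
    also have "\<dots> \<le> \<bar>B\<bar> * (norm x)\<^sup>2" by (rule mult_right_mono) auto
    finally show "(norm (ip x (v j)))\<^sup>2 \<le> (norm x * sqrt \<bar>B\<bar>)\<^sup>2"
      by (simp add: power_mult_distrib mult.commute)
  qed auto
  moreover have "ip (r *\<^sub>R x) (v j) = r *\<^sub>R ip x (v j)" for r x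
    using ip_smul_left[of "of_real r" x "v j"] by (simp add: smul_of_real scaleR_conv_of_real)
  ultimately have "bounded_linear (\<lambda>x. ip x (v j))"
    by (intro bounded_linear_intro) (auto simp: ip_add_left)
  then show ?thesis by (simp add: dual_space_def ip_smul_left)
qed

end

section \<open>Four-frames and stable phase retrieval\<close>

lemma powr_quarter_le_iff:
  fixes s t :: real
  assumes "0 \<le> s" "0 \<le> t"
  shows "s powr (1 / 4) \<le> t \<longleftrightarrow> s \<le> t ^ 4" and "t \<le> s powr (1 / 4) \<longleftrightarrow> t ^ 4 \<le> s"
proof -
  have "(s powr (1 / 4)) ^ 4 = s"
    using assms by (simp add: powr_powr flip: powr_numeral)
  then show "s powr (1 / 4) \<le> t \<longleftrightarrow> s \<le> t ^ 4" "t \<le> s powr (1 / 4) \<longleftrightarrow> t ^ 4 \<le> s"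
    using power_mono_iff[of "s powr (1 / 4)" t 4] power_mono_iff[of t "s powr (1 / 4)" 4] assms
    by auto
qed

theorem proposition3p6:
  fixes smul :: "'k::rc_field \<Rightarrow> 'a::banach \<Rightarrow> 'a"
    and ip :: "'a \<Rightarrow> 'a \<Rightarrow> 'k"
    and J :: "'i set"
    and v :: "'i \<Rightarrow> 'a"
    and B a0 :: real
  assumes "rc_hilbert_space smul ip"
    and "countable J"
    and "is_frame ip J v"
    and "bessel_bound ip J v B"
    and "a0 > 0"
    and "\<And>x y :: 'a.
      (\<Sum>\<^sub>\<infinity>j\<in>J. \<bar>(norm (ip x (v j)))\<^sup>2 - (norm (ip y (v j)))\<^sup>2\<bar>\<^sup>2)
        \<ge> a0 * ((norm (x - y))\<^sup>2 * (norm (x + y))\<^sup>2 - 4 * (Im (to_complex (ip x y)))\<^sup>2)"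
  shows "((\<exists>x::'a. x \<noteq> 0) \<longrightarrow>
           p_frame 4 smul J (\<lambda>j x. ip x (v j)) (a0 powr (1 / 4)) (B powr (1 / 2))) \<and>
         stable_phase_retrieval 4 smul J (\<lambda>j x. ip x (v j)) ((2 * inverse a0 * B) powr (1 / 2))"
proof -
  interpret rc_hilbert_space smul ip by fact
  define c where "c x j = norm (ip x (v j))" for x j
  have c_nonneg: "0 \<le> c x j" for x j by (simp add: c_def)
  have c_smul: "c (smul \<omega> y) = c y" if "norm \<omega> = 1" for \<omega> y
    using that by (simp add: fun_eq_iff c_def norm_ip_smul_left)
  have c_sum: "(\<lambda>j. (c x j)\<^sup>2) summable_on J" and c_le: "(\<Sum>\<^sub>\<infinity>j\<in>J. (c x j)\<^sup>2) \<le> B * (norm x)\<^sup>2" for x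
    using assms(4) by (auto simp: bessel_bound_def c_def)
  have c4_sum: "(\<lambda>j. c x j ^ 4) summable_on J"
    and c4_le: "(\<Sum>\<^sub>\<infinity>j\<in>J. c x j ^ 4) \<le> B\<^sup>2 * norm x ^ 4" for x
    using infsum_square_le[OF c_sum _ c_le, of x]
    by (simp_all add: power_mult_distrib flip: power_mult)
  have c4_ge: "a0 * norm x ^ 4 \<le> (\<Sum>\<^sub>\<infinity>j\<in>J. c x j ^ 4)" for x
    using assms(6)[of x 0] ip_conjugate[of 0 x] to_complex_of_real[of 0, where 'k='k]
    by (simp add: ip_zero_left c_def flip: power_mult power_add)
  note dual = bessel_imp_dual_space[OF assms(4)]
  have frame: "p_frame 4 smul J (\<lambda>j x. ip x (v j)) (a0 powr (1 / 4)) (B powr (1 / 2))"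
    and B_pos: "0 < B" if "x0 \<noteq> 0" for x0 :: 'a
  proof -
    have "0 \<le> B * (norm x0)\<^sup>2"
      using c_le[of x0] infsum_nonneg[of J "\<lambda>j. (c x0 j)\<^sup>2"] by auto
    then have B0: "0 \<le> B" using that by (simp add: zero_le_mult_iff)
    \<comment> \<open>The two fourth-power bounds can be compared as soon as there is a nonzero vector.\<close>
    have a0B: "a0 \<le> B\<^sup>2" using order_trans[OF c4_ge c4_le, of x0] that by simp
    then show "0 < B" using B0 assms(5) by (cases "B = 0") auto
    have lower: "a0 powr (1 / 4) * norm x \<le> (\<Sum>\<^sub>\<infinity>j\<in>J. c x j ^ 4) powr (1 / 4)" for x
      using c4_ge[of x] assms(5)
      by (subst powr_quarter_le_iff)
        (auto simp: power_mult_distrib powr_powr c_nonneg simp flip: powr_numeral intro!: infsum_nonneg)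
    have root4: "sqrt B ^ 4 = B\<^sup>2"
      using power_mult[of "sqrt B" 2 2] B0 by simp
    have upper: "(\<Sum>\<^sub>\<infinity>j\<in>J. c x j ^ 4) powr (1 / 4) \<le> B powr (1 / 2) * norm x" for x
      using c4_le[of x] B0
      by (subst powr_quarter_le_iff)
        (auto simp: power_mult_distrib powr_half_sqrt root4 c_nonneg intro!: infsum_nonneg)
    have "a0 powr (1 / 4) \<le> B powr (1 / 2)"
      using a0B assms(5) B0 by (subst powr_quarter_le_iff) (auto simp: powr_half_sqrt root4)
    then show "p_frame 4 smul J (\<lambda>j x. ip x (v j)) (a0 powr (1 / 4)) (B powr (1 / 2))"
      using assms(2,5) dual lower upper c4_sum by (auto simp: p_frame_def c_def)
  qed
  have ex_frame: "\<exists>A B. p_frame 4 smul J (\<lambda>j x. ip x (v j)) A B"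
  proof (cases "\<exists>x::'a. x \<noteq> 0")
    case True
    then show ?thesis using frame by blast
  next
    case False
    then have zero: "x = 0" for x :: 'a by blast
    have "ip x y = 0" and "norm x = 0" for x y
      using zero[of x] by (simp_all add: ip_zero_left)
    \<comment> \<open>On the zero space any two positive constants are frame bounds.\<close>
    then have "p_frame 4 smul J (\<lambda>j x. ip x (v j)) 1 1"
      using assms(2) dual by (simp add: p_frame_def)
    then show ?thesis by blast
  qed
  have stable: "(INF \<alpha>\<in>{\<alpha>. norm \<alpha> = 1}. norm (x - smul \<alpha> y)) \<le>
      (2 * inverse a0 * B) powr (1 / 2) * (\<Sum>\<^sub>\<infinity>j\<in>J. \<bar>c x j - c y j\<bar> powr 4) powr (1 / 4)"
    (is "?inf \<le> _") for x y
  proof -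
    define S where "S = (\<Sum>\<^sub>\<infinity>j\<in>J. (c x j - c y j) ^ 4)"
    have S0: "0 \<le> S" unfolding S_def by (rule infsum_nonneg) simp
    have rhs: "(\<Sum>\<^sub>\<infinity>j\<in>J. \<bar>c x j - c y j\<bar> powr 4) = S" by (simp add: S_def)
    obtain \<omega> where \<omega>: "norm \<omega> = 1"
      and ip\<omega>: "to_complex (ip x (smul \<omega> y)) = complex_of_real (norm (ip x y))"
      by (rule ex_unit_aligning)
    define z where "z = smul \<omega> y"
    have inf_le: "?inf \<le> norm (x - z)"
      unfolding z_def by (rule cINF_lower) (use \<omega> in \<open>auto intro!: bdd_belowI2[of _ 0]\<close>)
    have cz: "c z = c y" unfolding z_def by (rule c_smul[OF \<omega>])
    let ?N = "(norm x)\<^sup>2 + (norm z)\<^sup>2"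
    \<comment> \<open>The distance is only estimated at the aligning scalar: any unit scalar bounds the infimum.\<close>
    have "norm (x - z) \<le> (2 * inverse a0 * B) powr (1 / 2) * S powr (1 / 4)"
    proof (cases "x = 0 \<and> z = 0")
      case True
      then show ?thesis by simp
    next
      case False
      then have "0 < B" using B_pos by blast
      have N: "0 < ?N" using False by (simp add: sum_power2_gt_zero_iff)
      have "?N \<le> (norm (x + z))\<^sup>2"
        unfolding norm_add_square using ip\<omega> by (simp add: z_def)
      then have "a0 * ((norm (x - z))\<^sup>2 * ?N) \<le> a0 * ((norm (x - z))\<^sup>2 * (norm (x + z))\<^sup>2)"
        using assms(5) by (intro mult_left_mono) auto
      also have "\<dots> \<le> (\<Sum>\<^sub>\<infinity>j\<in>J. \<bar>(c x j)\<^sup>2 - (c z j)\<^sup>2\<bar>\<^sup>2)"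
        using assms(6)[of x z] ip\<omega> by (simp add: z_def c_def)
      also have "\<dots> \<le> sqrt S * (2 * (B * ?N))"
        unfolding S_def cz[symmetric]
        by (rule infsum_diff_squares_le[OF c_sum c_sum])
          (use c_le[of x] c_le[of z] in \<open>simp add: algebra_simps\<close>)
      finally have "(a0 * (norm (x - z))\<^sup>2) * ?N \<le> (2 * B * sqrt S) * ?N"
        by (simp only: mult_ac)
      then have "a0 * (norm (x - z))\<^sup>2 \<le> 2 * B * sqrt S"
        using N by (rule mult_right_le_imp_le)
      then have "(norm (x - z))\<^sup>2 \<le> 2 * inverse a0 * B * sqrt S"
        using assms(5) by (simp add: field_simps)
      then have "norm (x - z) \<le> sqrt (2 * inverse a0 * B * sqrt S)"
        by (rule real_le_rsqrt)
      also have "\<dots> = (2 * inverse a0 * B) powr (1 / 2) * S powr (1 / 4)"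
        using S0 \<open>0 < B\<close> assms(5)
        by (simp add: real_sqrt_mult[of "2 * inverse a0 * B"] powr_powr flip: powr_half_sqrt)
      finally show ?thesis .
    qed
    then show ?thesis using inf_le rhs by simp
  qed
  show ?thesis
    using frame ex_frame stable by (auto simp: stable_phase_retrieval_def c_def)
qed

end
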